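(* Every coarsely injective metric space of uniformly bounded geometry is strongly shortcut.
   Context: A metric space $(X,\sigma)$ is coarsely injective if there is a constant $\delta\ge 0$ such that for any family $\{B(x_i,r_i):i\in I\}$ of balls with $\sigma(x_i,x_j)\le r_i+r_j$ for all $i,j\in I$, the $\delta$-neighbourhoods of those balls have nonempty total intersection. A metric space has uniformly bounded geometry if, for any $r>0$, there exists $N(r)\in\mathbb N$ such that every ball of radius $r$ contains at most $N(r)$ points. A metric space $(X,\sigma)$ is roughly geodesic if there is $C\ge0$ such that for any $a,b\in X$ there is a $(1,C)$-quasi-isometric embedding $f:[0,\sigma(a,b)]\to X$ with $f(0)=a$ and $f(\sigma(a,b))=b$. (Coarsely injective spaces are roughly geodesic.) A map $f:(Y,d_Y)\to(X,\sigma)$ is a $(K,C)$-quasi-isometric embedding if $\frac1K d_Y(y,y')-C\le\sigma(f(y),f(y'))\le Kd_Y(y,y')+C$ for all $y,y'\in Y$. A Riemannian circle $S$ is the circle $S^1$ endowed with a geodesic metric of some length $|S|$. A roughly geodesic metric space $(X,\sigma)$ is strongly shortcut if there exists $K>1$ such that for any $C>0$ there is a bound on the lengths $|S|$ of Riemannian circles $S$ that admit a $(K,C)$-quasi-isometric embedding $S\to X$. *)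

theory Defs
  imports "HOL-Analysis.Analysis"
begin

definition qi_embedding ::
  "'b set \<Rightarrow> ('b \<Rightarrow> 'b \<Rightarrow> real) \<Rightarrow> 'a set \<Rightarrow> ('a \<Rightarrow> 'a \<Rightarrow> real) \<Rightarrow> real \<Rightarrow> real \<Rightarrow> ('b \<Rightarrow> 'a) \<Rightarrow> bool"
where
  "qi_embedding Y dY X dX K C f \<longleftrightarrow>
     f \<in> Y \<rightarrow> X \<and>
     (\<forall>y\<in>Y. \<forall>y'\<in>Y. (1 / K) * dY y y' - C \<le> dX (f y) (f y') \<and> dX (f y) (f y') \<le> K * dY y y' + C)"

text \<open>
  The Riemannian circle of length \<open>L\<close>: the unit circle in the complex plane, with distance the
  length of a shortest arc, where arc length is scaled so that the whole circle has length \<open>L\<close>.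
  Up to isometry this is the only geodesic metric of length \<open>L\<close> on the circle; the lemmas below
  show that it is a metric, that it is geodesic, and that the standard parametrization over
  \<open>[0, L]\<close> is a closed curve of unit speed.
\<close>

definition circle_dist :: "real \<Rightarrow> complex \<Rightarrow> complex \<Rightarrow> real" where
  "circle_dist L z w = L / (2 * pi) * \<bar>Arg (z / w)\<bar>"

lemma circle_dist_cis:
  assumes "\<bar>a - b\<bar> \<le> pi"
  shows "circle_dist L (cis a) (cis b) = L / (2 * pi) * \<bar>a - b\<bar>"
proof -
  have *: "\<bar>Arg (cis t)\<bar> = \<bar>t\<bar>" if "\<bar>t\<bar> \<le> pi" for t :: real
  proof (cases "t = - pi")
    case True
    then have "cis t = cis pi" by (simp add: complex_eq_iff)
    then have "Arg (cis t) = pi" using Arg_cis[of pi] by simp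
    then show ?thesis using True by simp
  next
    case False
    then have "t \<in> {- pi<..pi}" using that by auto
    then show ?thesis by (simp only: Arg_cis)
  qed
  show ?thesis using *[OF assms] by (simp add: circle_dist_def cis_divide)
qed

lemma abs_Arg_triangle:
  assumes "z \<noteq> 0" "w \<noteq> 0"
  shows "\<bar>Arg (z * w)\<bar> \<le> \<bar>Arg z\<bar> + \<bar>Arg w\<bar>"
proof -
  have "- pi < Arg z" "Arg z \<le> pi" "- pi < Arg w" "Arg w \<le> pi"
    using Arg_bounded by auto
  moreover have "Arg (z * w) = Arg z + Arg w \<or>
      Arg z + Arg w > pi \<and> Arg (z * w) = Arg z + Arg w - 2 * pi \<or>
      Arg z + Arg w \<le> - pi \<and> Arg (z * w) = Arg z + Arg w + 2 * pi"
    unfolding Arg_times'[OF assms] by auto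
  ultimately show ?thesis by linarith
qed

lemma Metric_space_circle:
  assumes "L > 0"
  shows "Metric_space (sphere 0 1) (circle_dist L)"
proof
  fix z w :: complex
  show "0 \<le> circle_dist L z w"
    using assms by (simp add: circle_dist_def)
  have "\<bar>Arg (inverse u)\<bar> = \<bar>Arg u\<bar>" for u
  proof (cases "u \<in> \<real>")
    case True
    then show ?thesis by (simp add: Arg_inverse)
  next
    case False
    then show ?thesis by (simp add: Arg_inverse)
  qed
  from this[of "z / w"] show "circle_dist L z w = circle_dist L w z"
    by (simp add: circle_dist_def)
next
  fix z w :: complex
  assume zw: "z \<in> sphere 0 1" "w \<in> sphere 0 1"
  show "circle_dist L z w = 0 \<longleftrightarrow> z = w"
  proof
    assume "circle_dist L z w = 0"
    then have "Arg (z / w) = 0" using assms by (simp add: circle_dist_def)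
    moreover have "norm (z / w) = 1" "z / w \<noteq> 0" using zw by (auto simp: norm_divide)
    ultimately have "z / w = 1" using Arg_eq[of "z / w"] by simp
    then show "z = w" by simp
  next
    assume "z = w"
    moreover have "w \<noteq> 0" using zw by auto
    ultimately show "circle_dist L z w = 0" by (simp add: circle_dist_def)
  qed
next
  fix u v w :: complex
  assume "u \<in> sphere 0 1" "v \<in> sphere 0 1" "w \<in> sphere 0 1"
  then have nz: "u \<noteq> 0" "v \<noteq> 0" "w \<noteq> 0" by auto
  then have "\<bar>Arg (u / w)\<bar> \<le> \<bar>Arg (u / v)\<bar> + \<bar>Arg (v / w)\<bar>"
    using abs_Arg_triangle[of "u / v" "v / w"] by simp
  then show "circle_dist L u w \<le> circle_dist L u v + circle_dist L v w"
    unfolding circle_dist_def distrib_left [symmetric]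
    using assms by (intro mult_left_mono) auto
qed

lemma circle_unit_speed:
  assumes "L > 0" "\<bar>s - t\<bar> \<le> L / 2"
  shows "circle_dist L (cis (2 * pi * s / L)) (cis (2 * pi * t / L)) = \<bar>s - t\<bar>"
proof -
  have e: "\<bar>2 * pi * s / L - 2 * pi * t / L\<bar> = 2 * pi / L * \<bar>s - t\<bar>"
    using assms(1) by (simp add: abs_mult flip: diff_divide_distrib right_diff_distrib)
  have "2 * pi / L * \<bar>s - t\<bar> \<le> 2 * pi / L * (L / 2)"
    using assms by (intro mult_left_mono) auto
  then show ?thesis
    using assms(1) by (subst circle_dist_cis) (auto simp: e)
qed

lemma circle_geodesic:
  assumes "L > 0" "z \<in> sphere 0 1" "w \<in> sphere 0 1"
  shows "\<exists>g. g \<in> {0..circle_dist L z w} \<rightarrow> sphere 0 1 \<and> g 0 = z \<and> g (circle_dist L z w) = w \<and>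
    (\<forall>s\<in>{0..circle_dist L z w}. \<forall>t\<in>{0..circle_dist L z w}. circle_dist L (g s) (g t) = \<bar>s - t\<bar>)"
proof -
  define D where "D = circle_dist L z w"
  define e where "e = - sgn (Arg (z / w))"
  define g where "g t = z * cis (2 * pi * (e * t) / L)" for t
  have nz: "z \<noteq> 0" "w \<noteq> 0" using assms by auto
  have n1: "norm (z / w) = 1" using assms by (simp add: norm_divide)
  have D: "D = L / (2 * pi) * \<bar>Arg (z / w)\<bar>" by (simp add: D_def circle_dist_def)
  have "\<bar>Arg (z / w)\<bar> \<le> pi" using Arg_bounded[of "z / w"] by auto
  then have "L / (2 * pi) * \<bar>Arg (z / w)\<bar> \<le> L / (2 * pi) * pi"
    using assms by (intro mult_left_mono) auto
  then have DL: "D \<le> L / 2" by (simp add: D)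
  have end_angle: "2 * pi * (e * D) / L = - Arg (z / w)"
    using assms(1) by (simp add: D e_def sgn_if)
  have "z / w = cis (Arg (z / w))"
    using Arg_eq[of "z / w"] n1 nz by (simp add: cis_conv_exp)
  then have "inverse (cis (Arg (z / w))) = inverse (z / w)" by (rule arg_cong [OF sym])
  then have "cis (- Arg (z / w)) = w / z"
    by (simp only: cis_inverse inverse_divide)
  then have "g D = w" using nz by (simp add: g_def end_angle)
  moreover have "g 0 = z" by (simp add: g_def)
  moreover have "g t \<in> sphere 0 1" for t using assms by (simp add: g_def norm_mult)
  moreover have "circle_dist L (g s) (g t) = \<bar>s - t\<bar>" if "s \<in> {0..D}" "t \<in> {0..D}" for s t
  proof -
    have st: "\<bar>s - t\<bar> \<le> D" using that by auto
    have "circle_dist L (g s) (g t) =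
        circle_dist L (cis (2 * pi * (e * s) / L)) (cis (2 * pi * (e * t) / L))"
      using nz by (simp add: circle_dist_def g_def)
    also have "\<dots> = \<bar>e * s - e * t\<bar>"
    proof (rule circle_unit_speed[OF assms(1)])
      have "\<bar>e * s - e * t\<bar> = \<bar>e\<bar> * \<bar>s - t\<bar>" by (simp add: abs_mult flip: right_diff_distrib)
      also have "\<dots> \<le> \<bar>s - t\<bar>" by (simp add: e_def sgn_if)
      finally show "\<bar>e * s - e * t\<bar> \<le> L / 2" using st DL by linarith
    qed
    also have "\<dots> = \<bar>s - t\<bar>"
    proof (cases "Arg (z / w) = 0")
      case True
      then show ?thesis using that D by simp
    next
      case False
      then show ?thesis by (auto simp: e_def sgn_if)
    qed
    finally show ?thesis .
  qed
  ultimately show ?thesis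
    unfolding D_def [symmetric] by (intro exI [of _ g]) simp
qed

context Metric_space
begin

definition nbhd :: "real \<Rightarrow> 'a set \<Rightarrow> 'a set" where
  "nbhd \<delta> A = {y \<in> M. \<exists>a\<in>A. d a y \<le> \<delta>}"

text \<open>
  A family of balls is given by the set \<open>F\<close> of its (centre, radius) pairs; this loses nothing, since
  neither the hypothesis nor the conclusion is affected by repetitions in an indexed family.
  Taking both pairs equal shows that radii are nonnegative. Balls are closed, and the
  intersection of the empty family is \<open>M\<close>.
\<close>

definition coarsely_injective :: bool where
  "coarsely_injective \<longleftrightarrow>
     (\<exists>\<delta>\<ge>0. \<forall>F \<subseteq> M \<times> (UNIV :: real set).
        (\<forall>(x, r)\<in>F. \<forall>(y, s)\<in>F. d x y \<le> r + s) \<longrightarrow>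
        M \<inter> (\<Inter>(x, r)\<in>F. nbhd \<delta> (mcball x r)) \<noteq> {})"

definition uniformly_bounded_geometry :: bool where
  "uniformly_bounded_geometry \<longleftrightarrow>
     (\<forall>r>0. \<exists>N::nat. \<forall>x\<in>M. finite (mcball x r) \<and> card (mcball x r) \<le> N)"

definition roughly_geodesic :: bool where
  "roughly_geodesic \<longleftrightarrow>
     (\<exists>C\<ge>0. \<forall>a\<in>M. \<forall>b\<in>M. \<exists>f.
        qi_embedding {0..d a b} dist M d 1 C f \<and> f 0 = a \<and> f (d a b) = b)"

definition strongly_shortcut :: bool where
  "strongly_shortcut \<longleftrightarrow>
     roughly_geodesic \<and>
     (\<exists>K>1. \<forall>C>0. \<exists>B. \<forall>L>0.
        (\<exists>f. qi_embedding (sphere 0 1) (circle_dist L) M d K C f) \<longrightarrow> L \<le> B)"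

end

end

theory Submission
  imports Defs
begin

text \<open>
  Take \<open>2n\<close> equally spaced points on a long circle, forming \<open>n\<close> antipodal pairs. If \<open>K\<close> is
  sufficiently close to \<open>1\<close> in terms of \<open>n\<close>, then in the image of a \<open>(K, C)\<close>-quasi-isometric
  embedding the pairs remain almost antipodal: half the sum of the distances within two pairs
  exceeds every distance between them by an amount proportional to the length of the circle.
  So one may move the balls whose radii are half the distance within each pair by \<open>\<plusminus>r\<close>, with
  independent signs for the \<open>n\<close> pairs, and they still meet pairwise. Coarse injectivity turns the
  \<open>2^n\<close> sign vectors into \<open>2^n\<close> distinct points in one ball whose radius only depends on the
  injectivity constant. As \<open>n\<close> can be fixed before \<open>C\<close>, bounded geometry bounds the length.

  Rough geodesics from \<open>a\<close> to \<open>b\<close> come from the segment joining \<open>d a\<close> to \<open>d b\<close> in the space of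
  functions \<open>f\<close> with \<open>d x y \<le> f x + f y\<close>: a nonexpanding operator makes its points almost
  minimal, and an almost minimal function is uniformly close to the distance from a point.
\<close>

section \<open>A Helly-type form of coarse injectivity\<close>

context Metric_space
begin

text \<open>Lying in the \<open>\<delta>\<close>-neighbourhood of a ball is relaxed to a distance
  estimate to its centre, which is all that the later arguments use.\<close>

definition coarse_helly :: "real \<Rightarrow> bool" where
  "coarse_helly \<delta> \<longleftrightarrow>
     (\<forall>F \<subseteq> M \<times> UNIV. (\<forall>(x, r)\<in>F. \<forall>(y, s)\<in>F. d x y \<le> r + s) \<longrightarrow>
        (\<exists>p\<in>M. \<forall>(x, r)\<in>F. d p x \<le> r + \<delta>))"

lemma coarsely_injective_imp_coarse_helly:
  assumes "coarsely_injective"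
  obtains \<delta> where "\<delta> \<ge> 0" "coarse_helly \<delta>"
proof -
  obtain \<delta> where "\<delta> \<ge> 0" and \<delta>: "\<And>F. F \<subseteq> M \<times> (UNIV :: real set) \<Longrightarrow>
      (\<forall>(x, r)\<in>F. \<forall>(y, s)\<in>F. d x y \<le> r + s) \<Longrightarrow> M \<inter> (\<Inter>(x, r)\<in>F. nbhd \<delta> (mcball x r)) \<noteq> {}"
    using assms unfolding coarsely_injective_def by blast
  have "coarse_helly \<delta>"
    unfolding coarse_helly_def
  proof (intro allI impI)
    fix F :: "('a \<times> real) set"
    assume "F \<subseteq> M \<times> UNIV" "\<forall>(x, r)\<in>F. \<forall>(y, s)\<in>F. d x y \<le> r + s"
    then obtain p where p: "p \<in> M" "p \<in> (\<Inter>(x, r)\<in>F. nbhd \<delta> (mcball x r))"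
      using \<delta> by blast
    have "d p x \<le> r + \<delta>" if "(x, r) \<in> F" for x r
    proof -
      have "p \<in> nbhd \<delta> (mcball x r)" using p(2) that by auto
      then obtain q where "q \<in> mcball x r" "d q p \<le> \<delta>" by (auto simp: nbhd_def)
      then show ?thesis
        using triangle[of p q x] p(1) commute[of x q] commute[of q p] by auto
    qed
    then show "\<exists>p\<in>M. \<forall>(x, r)\<in>F. d p x \<le> r + \<delta>" using p(1) by auto
  qed
  with \<open>\<delta> \<ge> 0\<close> show ?thesis using that by blast
qed

lemma coarse_hellyD:
  assumes "coarse_helly \<delta>" "c \<in> I \<rightarrow> M"
    and "\<And>i j. i \<in> I \<Longrightarrow> j \<in> I \<Longrightarrow> d (c i) (c j) \<le> r i + r j"
  obtains p where "p \<in> M" "\<And>i. i \<in> I \<Longrightarrow> d p (c i) \<le> r i + \<delta>"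
proof -
  define F where "F = (\<lambda>i. (c i, r i)) ` I"
  have "F \<subseteq> M \<times> UNIV" using assms(2) by (auto simp: F_def)
  moreover have "\<forall>(x, r)\<in>F. \<forall>(y, s)\<in>F. d x y \<le> r + s"
    using assms(3) by (auto simp: F_def)
  ultimately have "\<exists>p\<in>M. \<forall>(x, r)\<in>F. d p x \<le> r + \<delta>"
    using assms(1) unfolding coarse_helly_def by blast
  then show ?thesis using that by (auto simp: F_def)
qed

subsection \<open>Rough geodesics\<close>

definition admissible :: "('a \<Rightarrow> real) \<Rightarrow> bool" where
  "admissible f \<longleftrightarrow> (\<forall>x\<in>M. \<forall>y\<in>M. d x y \<le> f x + f y)"

text \<open>The conjugate from Isbell's injective hull, or tight span: the minimal admissible
  functions are the fixed points. Admissibility bounds the supremum by \<open>f x\<close>.\<close>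

definition conjugate :: "('a \<Rightarrow> real) \<Rightarrow> 'a \<Rightarrow> real" where
  "conjugate f x = (SUP y\<in>M. d x y - f y)"

definition tighten :: "('a \<Rightarrow> real) \<Rightarrow> 'a \<Rightarrow> real" where
  "tighten f x = (f x + conjugate f x) / 2"

lemma conjugate_le:
  assumes "M \<noteq> {}" "\<And>y. y \<in> M \<Longrightarrow> d x y - f y \<le> c"
  shows "conjugate f x \<le> c"
  unfolding conjugate_def using assms by (intro cSUP_least) auto

lemma conjugate_ge:
  assumes "admissible f" "x \<in> M" "y \<in> M"
  shows "d x y - f y \<le> conjugate f x"
  unfolding conjugate_def
proof (rule cSUP_upper[OF assms(3)])
  show "bdd_above ((\<lambda>y. d x y - f y) ` M)"
    using assms by (intro bdd_aboveI[of _ "f x"]) (auto simp: admissible_def algebra_simps)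
qed

lemma conjugate_le_self:
  assumes "admissible f" "x \<in> M"
  shows "conjugate f x \<le> f x"
  using assms by (intro conjugate_le) (auto simp: admissible_def algebra_simps)

lemma conjugate_antimono:
  assumes "admissible f" "\<And>y. y \<in> M \<Longrightarrow> f y \<le> g y + c" "x \<in> M"
  shows "conjugate g x \<le> conjugate f x + c"
proof (rule conjugate_le)
  fix y assume y: "y \<in> M"
  show "d x y - g y \<le> conjugate f x + c"
    using conjugate_ge[OF assms(1,3) y] assms(2)[OF y] by simp
qed (use assms in auto)

lemma tighten_le_self:
  assumes "admissible f" "x \<in> M"
  shows "tighten f x \<le> f x"
  using conjugate_le_self[OF assms] by (simp add: tighten_def)

text \<open>The bound \<open>conjugate_ge\<close>, used for \<open>(x, y)\<close> and for
  \<open>(y, x)\<close>, gives two inequalities whose average is the claim.\<close>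

lemma admissible_tighten:
  assumes "admissible f"
  shows "admissible (tighten f)"
  unfolding admissible_def
proof (intro ballI)
  fix x y assume xy: "x \<in> M" "y \<in> M"
  show "d x y \<le> tighten f x + tighten f y"
    using conjugate_ge[OF assms xy] conjugate_ge[OF assms xy(2,1)] commute[of x y]
    unfolding tighten_def by argo
qed

text \<open>Conjugation reverses order, so the upper bound on \<open>f\<close> handles the first
  half of the average and the upper bound on \<open>g\<close> the second.\<close>

lemma tighten_nonexpanding:
  assumes "admissible g" "\<And>y. y \<in> M \<Longrightarrow> f y \<le> g y + c" "\<And>y. y \<in> M \<Longrightarrow> g y \<le> f y + c" "x \<in> M"
  shows "tighten f x \<le> tighten g x + c"
proof -
  have "conjugate f x \<le> conjugate g x + c"
    by (rule conjugate_antimono) (use assms in auto)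
  with assms(2)[OF assms(4)] show ?thesis unfolding tighten_def by argo
qed

text \<open>Tightening lowers \<open>f\<close>, hence can only raise the conjugate, while the
  average already lies halfway between \<open>f\<close> and its old conjugate.\<close>

lemma tighten_gap:
  assumes "admissible f" "x \<in> M"
  shows "tighten f x - conjugate (tighten f) x \<le> (f x - conjugate f x) / 2"
proof -
  have "conjugate f x \<le> conjugate (tighten f) x + 0"
    using assms by (intro conjugate_antimono) (auto simp: admissible_tighten tighten_le_self)
  then show ?thesis unfolding tighten_def[of f x] by argo
qed

lemma admissible_tighten_iter: "admissible f \<Longrightarrow> admissible ((tighten ^^ k) f)"
  by (induction k) (auto simp: admissible_tighten)

lemma tighten_iter_le_self:
  assumes "admissible f" "x \<in> M"
  shows "(tighten ^^ k) f x \<le> f x"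
proof (induction k)
  case (Suc k)
  then show ?case
    using tighten_le_self[OF admissible_tighten_iter[OF assms(1), of k] assms(2)] by simp
qed simp

lemma tighten_iter_nonexpanding:
  assumes "admissible f" "admissible g"
    and "\<And>y. y \<in> M \<Longrightarrow> \<bar>f y - g y\<bar> \<le> c" "x \<in> M"
  shows "\<bar>(tighten ^^ k) f x - (tighten ^^ k) g x\<bar> \<le> c"
  using assms(4)
proof (induction k arbitrary: x)
  case 0
  then show ?case using assms(3) by simp
next
  case (Suc k)
  define F G where "F = (tighten ^^ k) f" and "G = (tighten ^^ k) g"
  have adm: "admissible F" "admissible G"
    unfolding F_def G_def using assms by (auto intro: admissible_tighten_iter)
  have *: "F y \<le> G y + c" "G y \<le> F y + c" if "y \<in> M" for y
    using Suc.IH[OF that] unfolding F_def G_def by linarith+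
  have "tighten F x \<le> tighten G x + c" "tighten G x \<le> tighten F x + c"
    by (rule tighten_nonexpanding; use adm * Suc.prems in blast)+
  then show ?case unfolding F_def G_def by simp
qed

lemma tighten_iter_gap:
  assumes "admissible f" "x \<in> M"
  shows "(tighten ^^ k) f x - conjugate ((tighten ^^ k) f) x \<le> (f x - conjugate f x) / 2 ^ k"
proof (induction k)
  case (Suc k)
  then show ?case
    using tighten_gap[OF admissible_tighten_iter[OF assms(1), of k] assms(2)] by simp
qed simp

lemma coarse_helly_imp_roughly_geodesic:
  assumes "\<delta> \<ge> 0" "coarse_helly \<delta>"
  shows "roughly_geodesic"
  unfolding roughly_geodesic_def
proof (intro exI[of _ "2 * \<delta> + 1"] conjI ballI)
  fix a b assume ab: "a \<in> M" "b \<in> M"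
  define D where "D = d a b"
  have D0: "D \<ge> 0" by (simp add: D_def)
  \<comment> \<open>If \<open>D = 0\<close>, division by zero gives \<open>f t = d a\<close>, as it
    should since then \<open>a = b\<close>.\<close>
  define f where "f t x = d a x + t / D * (d b x - d a x)" for t x
  have diff: "\<bar>d b x - d a x\<bar> \<le> D" if "x \<in> M" for x
    using ab that triangle[of a b x] triangle[of b a x] commute[of a b] unfolding D_def by linarith
  have flip: "\<bar>t / D * (d b x - d a x) - s / D * (d b x - d a x)\<bar> \<le> \<bar>s - t\<bar>"
    if "x \<in> M" for s t x
  proof -
    have "\<bar>t / D * (d b x - d a x) - s / D * (d b x - d a x)\<bar> = \<bar>s - t\<bar> * (\<bar>d b x - d a x\<bar> / D)"
      using D0 by (simp flip: left_diff_distrib diff_divide_distrib add: abs_mult abs_minus_commute)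
    also have "\<dots> \<le> \<bar>s - t\<bar> * 1"
      using diff[OF that] D0 by (intro mult_left_mono) (auto simp: divide_le_eq_1)
    finally show ?thesis by simp
  qed
  have adm: "admissible (f t)" if "t \<in> {0..D}" for t
    unfolding admissible_def
  proof (intro ballI)
    fix x y assume xy: "x \<in> M" "y \<in> M"
    define u where "u = t / D"
    have u: "0 \<le> u" "u \<le> 1" using that by (auto simp: u_def divide_le_eq_1)
    have "(1 - u) * d x y + u * d x y \<le> (1 - u) * (d a x + d a y) + u * (d b x + d b y)"
      using u ab xy triangle''[of x a y] triangle''[of x b y] commute
      by (intro add_mono mult_left_mono) auto
    then show "d x y \<le> f t x + f t y" by (simp add: f_def flip: u_def) (simp add: algebra_simps)
  qed
  have f_a: "f t a = t" if "t \<in> {0..D}" for t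
    using that ab by (cases "D = 0") (auto simp: f_def D_def commute)
  have f_b: "f t b = D - t" if "t \<in> {0..D}" for t
    using that ab by (cases "D = 0") (auto simp: f_def D_def commute field_simps)
  \<comment> \<open>The gap between \<open>f t\<close> and its conjugate is at most
    \<open>2 * t \<le> 2 * D\<close>, so \<open>k\<close> halvings bring it to at most 1, with the
    same \<open>k\<close> for all \<open>t\<close>.\<close>
  obtain k :: nat where k: "2 * D \<le> 2 ^ k"
    using real_arch_pow[of 2 "2 * D"] by (auto intro: less_imp_le)
  define h where "h t = (tighten ^^ k) (f t)" for t
  have h_adm: "admissible (h t)" if "t \<in> {0..D}" for t
    unfolding h_def using adm that by (intro admissible_tighten_iter)
  have h_le: "h t x \<le> f t x" if "t \<in> {0..D}" "x \<in> M" for t x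
    unfolding h_def using adm that by (intro tighten_iter_le_self) auto
  have h_lip: "\<bar>h s x - h t x\<bar> \<le> \<bar>s - t\<bar>" if "s \<in> {0..D}" "t \<in> {0..D}" "x \<in> M" for s t x
    unfolding h_def
  proof (rule tighten_iter_nonexpanding)
    show "\<bar>f s y - f t y\<bar> \<le> \<bar>s - t\<bar>" if "y \<in> M" for y
      using flip[OF that, of t s] by (simp add: f_def abs_minus_commute)
  qed (use adm that in auto)
  have h_gap: "h t x \<le> conjugate (h t) x + 1" if t: "t \<in> {0..D}" and x: "x \<in> M" for t x
  proof -
    have "f t x \<le> d a x + t" using abs_le_D1[OF flip[OF x, of t 0]] t by (auto simp: f_def)
    moreover have "d a x - t \<le> conjugate (f t) x"
      using conjugate_ge[OF adm[OF t] x ab(1)] f_a[OF t] by (simp add: commute)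
    ultimately have "f t x - conjugate (f t) x \<le> 2 ^ k" using t k by auto
    then have "(f t x - conjugate (f t) x) / 2 ^ k \<le> 1" by (simp add: divide_le_eq_1)
    then show ?thesis
      using tighten_iter_gap[OF adm[OF t] x, of k] unfolding h_def by linarith
  qed
  \<comment> \<open>The point \<open>p\<close> represents \<open>h t\<close>. For the upper bound on
    \<open>d p q\<close>, the first estimate is used for one point, the second for the other, and
    \<open>h_lip\<close> links the two parameters.\<close>
  define good where "good t p \<longleftrightarrow> p \<in> M \<and> (\<forall>x\<in>M. d p x \<le> h t x + \<delta>) \<and> h t p \<le> \<delta> + 1" for t p
  have ex_good: "\<exists>p. good t p" if t: "t \<in> {0..D}" for t
  proof -
    obtain p where p: "p \<in> M" "\<And>x. x \<in> M \<Longrightarrow> d p x \<le> h t x + \<delta>"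
      using coarse_hellyD[OF assms(2), of "\<lambda>x. x" M "h t"] h_adm[OF t]
      unfolding admissible_def by auto
    \<comment> \<open>The Helly estimate, rearranged, is a bound on the conjugate; the small gap
      turns it into one on \<open>h t p\<close>.\<close>
    have "conjugate (h t) p \<le> \<delta>"
      using p by (intro conjugate_le) (auto simp: algebra_simps)
    with h_gap[OF t p(1)] p show ?thesis unfolding good_def by force
  qed
  have end_good: "good t p" if t: "t \<in> {0..D}" and p: "p \<in> M" "f t p = 0" for t p
  proof -
    have "h t p \<le> 0" using h_le[OF t p(1)] p(2) by simp
    moreover have "d p x \<le> h t p + h t x" if "x \<in> M" for x
      using h_adm[OF t] p that by (auto simp: admissible_def)
    ultimately show ?thesis using p assms(1) unfolding good_def by force
  qed
  have good_upper: "d p q \<le> \<bar>s - t\<bar> + 2 * \<delta> + 1"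
    if "s \<in> {0..D}" "t \<in> {0..D}" "good s p" "good t q" for s t p q
  proof -
    have "d q p \<le> h t p + \<delta>" "h s p \<le> \<delta> + 1" "p \<in> M"
      using that unfolding good_def by auto
    then show ?thesis using h_lip[of s t p] that commute[of p q] by auto
  qed
  \<comment> \<open>The points \<open>p\<close> and \<open>q\<close> are close enough to
    \<open>a\<close> and \<open>b\<close> respectively that a path through both from
    \<open>a\<close> to \<open>b\<close> leaves nearly \<open>t - s\<close> between them.\<close>
  have good_lower: "t - s - 2 * \<delta> \<le> d p q"
    if st: "s \<in> {0..D}" "t \<in> {0..D}" and pq: "good s p" "good t q" for s t p q
  proof -
    have M: "p \<in> M" "q \<in> M" using pq unfolding good_def by auto
    have "d p a \<le> s + \<delta>" "d q b \<le> D - t + \<delta>"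
      using pq ab h_le[OF st(1) ab(1)] h_le[OF st(2) ab(2)] f_a[OF st(1)] f_b[OF st(2)]
      unfolding good_def by fastforce+
    moreover have "D \<le> d p a + d p q + d q b"
      using ab M triangle[of a p b] triangle[of p q b] commute[of a p] unfolding D_def by linarith
    ultimately show ?thesis by linarith
  qed
  define g where "g t = (if t = 0 then a else if t = D then b else SOME p. good t p)" for t
  have g: "good t (g t)" if "t \<in> {0..D}" for t
    unfolding g_def using that ex_good[OF that, THEN someI_ex] end_good[OF that] ab
      f_a[OF that] f_b[OF that] by auto
  have "qi_embedding {0..D} dist M d 1 (2 * \<delta> + 1) g"
    unfolding qi_embedding_def
  proof (intro conjI ballI)
    show "g \<in> {0..D} \<rightarrow> M" using g unfolding good_def by auto
    fix s t assume st: "s \<in> {0..D}" "t \<in> {0..D}"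
    show "1 / 1 * dist s t - (2 * \<delta> + 1) \<le> d (g s) (g t)"
      using good_lower[OF st g g] good_lower[OF st(2,1) g g] st commute[of "g s" "g t"]
      by (auto simp: dist_real_def abs_if)
    show "d (g s) (g t) \<le> 1 * dist s t + (2 * \<delta> + 1)"
      using good_upper[OF st g g] st by (simp add: dist_real_def)
  qed
  moreover have "g 0 = a" by (simp add: g_def)
  moreover have "g D = b"
    using ab by (auto simp: g_def D_def)
  ultimately show "\<exists>f. qi_embedding {0..d a b} dist M d 1 (2 * \<delta> + 1) f \<and> f 0 = a \<and> f (d a b) = b"
    unfolding D_def by blast
qed (use assms in auto)

subsection \<open>Almost antipodal pairs\<close>

text \<open>Each subset \<open>A\<close> of the indices is a sign vector, and the points obtained
  for different \<open>A\<close> are separated because \<open>\<delta> < r\<close>.\<close>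

lemma coarse_helly_antipodal_pairs:
  fixes x :: "nat \<Rightarrow> bool \<Rightarrow> 'a"
  defines "D \<equiv> \<lambda>i. d (x i True) (x i False)"
  assumes helly: "coarse_helly \<delta>" and \<delta>: "0 \<le> \<delta>" "\<delta> < r"
    and x: "\<And>i s. i < n \<Longrightarrow> x i s \<in> M"
    and D: "\<And>i. i < n \<Longrightarrow> 2 * r \<le> D i"
    and slack: "\<And>i j s s'. i < n \<Longrightarrow> j < n \<Longrightarrow> i \<noteq> j \<Longrightarrow> d (x i s) (x j s') + 2 * r \<le> (D i + D j) / 2"
  obtains p where "p \<in> M" "finite (mcball p (2 * r + 2 * \<delta>)) \<Longrightarrow> 2 ^ n \<le> card (mcball p (2 * r + 2 * \<delta>))"
proof -
  have r: "\<delta> < r" "0 \<le> r" using \<delta> by auto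
  \<comment> \<open>The two radii of a pair always sum to \<open>D i\<close>, so balls of one pair
    meet; \<open>slack\<close> covers different pairs even when both radii shrink.\<close>
  define \<rho> where "\<rho> A i s = D i / 2 + (if (i \<in> A) = s then r else - r)" for A i s
  have \<rho>: "d (x i s) (x j s') \<le> \<rho> A i s + \<rho> A j s'" if "i < n" "j < n" for A i j s s'
  proof (cases "i = j")
    case True
    with that x[of i] D[of i] commute[of "x i True" "x i False"] r show ?thesis
      by (cases s; cases s') (auto simp: \<rho>_def D_def)
  next
    case False
    have "D i / 2 - r \<le> \<rho> A i s" "D j / 2 - r \<le> \<rho> A j s'" using r by (auto simp: \<rho>_def)
    with slack[OF that False, of s s'] show ?thesis by argo
  qed
  obtain p where p: "p \<in> M" "\<And>i s. i < n \<Longrightarrow> d p (x i s) \<le> \<rho> {} i s + \<delta>"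
  proof (rule coarse_hellyD[OF helly])
    show "(\<lambda>(i, s). x i s) \<in> {..<n} \<times> UNIV \<rightarrow> M" using x by auto
    show "d (case u of (i, s) \<Rightarrow> x i s) (case v of (i, s) \<Rightarrow> x i s)
        \<le> (case u of (i, s) \<Rightarrow> \<rho> {} i s) + (case v of (i, s) \<Rightarrow> \<rho> {} i s)"
      if "u \<in> {..<n} \<times> UNIV" "v \<in> {..<n} \<times> UNIV" for u v
      using that \<rho> by auto
  qed (force intro: that)
  have "\<exists>q. q \<in> M \<and> d q p \<le> 2 * r + 2 * \<delta> \<and> (\<forall>i<n. \<forall>s. d q (x i s) \<le> \<rho> A i s + \<delta>)" for A
  proof -
    \<comment> \<open>The index \<open>None\<close> adds a ball about the reference point
      \<open>p\<close>, which confines the new point. Changing \<open>A\<close> alters a radius by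
      at most \<open>2 * r\<close>, so radius \<open>2 * r + \<delta>\<close> suffices for this ball
      to meet the others.\<close>
    define c where "c = case_option p (\<lambda>(i, s). x i s)"
    define R where "R = case_option (2 * r + \<delta>) (\<lambda>(i, s). \<rho> A i s)"
    define I where "I = insert None (Some ` ({..<n} \<times> (UNIV :: bool set)))"
    have p\<rho>: "d p (x i s) \<le> 2 * r + \<delta> + \<rho> A i s" if "i < n" for i s
      using p(2)[OF that, of s] r unfolding \<rho>_def by (auto split: if_splits)
    then have xp\<rho>: "d (x i s) p \<le> \<rho> A i s + (2 * r + \<delta>)" if "i < n" for i s
      using that by (simp add: commute add.commute)
    have "d (c u) (c v) \<le> R u + R v" if "u \<in> I" "v \<in> I" for u v
      using that p(1) r \<delta> \<rho> p\<rho> xp\<rho>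
      unfolding I_def c_def R_def by auto
    moreover have "c \<in> I \<rightarrow> M" using p(1) x by (auto simp: c_def I_def)
    ultimately obtain q where q: "q \<in> M" "\<And>u. u \<in> I \<Longrightarrow> d q (c u) \<le> R u + \<delta>"
      using coarse_hellyD[OF helly] by metis
    have "d q p \<le> 2 * r + 2 * \<delta>" using q(2)[of None] by (simp add: I_def c_def R_def)
    moreover have "d q (x i s) \<le> \<rho> A i s + \<delta>" if "i < n" for i s
      using q(2)[of "Some (i, s)"] that by (simp add: I_def c_def R_def)
    ultimately show ?thesis using q(1) by blast
  qed
  then obtain P where P: "\<And>A. P A \<in> M" "\<And>A. d (P A) p \<le> 2 * r + 2 * \<delta>"
      "\<And>A i s. i < n \<Longrightarrow> d (P A) (x i s) \<le> \<rho> A i s + \<delta>"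
    by metis
  \<comment> \<open>At an index in \<open>A\<close> but not in \<open>B\<close>, the common point
    would be within \<open>D i / 2 - r + \<delta>\<close> of both ends, against the triangle
    inequality.\<close>
  have sub: "A \<subseteq> B" if "P A = P B" "A \<subseteq> {..<n}" for A B
  proof
    fix i assume i: "i \<in> A"
    then have "i < n" using that by auto
    show "i \<in> B"
    proof (rule ccontr)
      assume "i \<notin> B"
      have "d (P A) (x i False) \<le> D i / 2 - r + \<delta>"
        using P(3)[OF \<open>i < n\<close>, of A False] i by (simp add: \<rho>_def)
      moreover have "d (P A) (x i True) \<le> D i / 2 - r + \<delta>"
        using P(3)[OF \<open>i < n\<close>, of B True] \<open>i \<notin> B\<close> that(1) by (simp add: \<rho>_def)
      moreover have "D i \<le> d (P A) (x i True) + d (P A) (x i False)"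
        unfolding D_def using triangle''[of "x i True" "P A" "x i False"] P(1) x[OF \<open>i < n\<close>]
        by (simp add: commute)
      ultimately show False using r by argo
    qed
  qed
  have inj: "inj_on P (Pow {..<n})"
    by (intro inj_onI subset_antisym) (metis PowD sub)+
  have img: "P ` Pow {..<n} \<subseteq> mcball p (2 * r + 2 * \<delta>)"
    using P p by (auto simp: commute)
  have "2 ^ n \<le> card (mcball p (2 * r + 2 * \<delta>))" if "finite (mcball p (2 * r + 2 * \<delta>))"
    using card_inj_on_le[OF inj img that] by (simp add: card_Pow)
  with p(1) show ?thesis using that by blast
qed

end

section \<open>Distances between equally spaced points of the circle\<close>

lemma circle_dist_minus: "circle_dist L (- z) (- w) = circle_dist L z w"
  by (simp add: circle_dist_def)

lemma circle_dist_antipodal: "circle_dist L (cis a) (- cis a) = L / 2"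
  using circle_dist_cis[of a "a + pi" L] by (simp add: minus_cis)

text \<open>The angle between the two lines lies in \<open>[pi / n, pi * (1 - 1 / n)]\<close>, an
  interval preserved by \<open>u \<mapsto> pi - u\<close>, which is the effect of negating one
  point.\<close>

lemma circle_dist_roots:
  fixes i j n :: nat and e e' :: complex
  assumes "i < n" "j < n" "i \<noteq> j" "L > 0" "e \<in> {1, -1}" "e' \<in> {1, -1}"
  shows "circle_dist L (e * cis (pi * i / n)) (e' * cis (pi * j / n)) \<le> L / 2 * (1 - 1 / n)"
proof -
  define t where "t = pi * i / n - pi * j / n"
  have "\<bar>t\<bar> = pi * (\<bar>real i - real j\<bar> / n)"
    unfolding t_def by (simp add: abs_mult flip: right_diff_distrib diff_divide_distrib)
  moreover have "1 / n \<le> \<bar>real i - real j\<bar> / n" "\<bar>real i - real j\<bar> / n \<le> 1 - 1 / n"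
    using assms(1-3) by (auto simp: field_simps)
  ultimately have t: "pi * (1 / n) \<le> \<bar>t\<bar>" "\<bar>t\<bar> \<le> pi * (1 - 1 / n)"
    by (metis mult_left_mono pi_ge_zero)+
  have "0 < pi * (1 / n)" using assms(1) by simp
  then have "0 < \<bar>t\<bar>" using t(1) by linarith
  have "pi * (1 - 1 / n) \<le> pi * 1" by (intro mult_left_mono) auto
  with t(2) have tpi: "\<bar>t\<bar> \<le> pi" by linarith
  have bound: "L / (2 * pi) * u \<le> L / 2 * (1 - 1 / n)" if "u \<le> pi * (1 - 1 / n)" for u
    using mult_left_mono[OF that, of "L / (2 * pi)"] assms(4) by simp
  have same: "circle_dist L (cis (pi * i / n)) (cis (pi * j / n)) \<le> L / 2 * (1 - 1 / n)"
    using circle_dist_cis[of "pi * i / n" "pi * j / n" L] tpi t(2) bound by (simp flip: t_def)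
  \<comment> \<open>The direction of the half turn follows the sign of \<open>t\<close>, keeping the
    angle difference within the range of \<open>circle_dist_cis\<close>.\<close>
  have shift: "- cis (pi * j / n) = cis (pi * j / n + sgn t * pi)"
    using \<open>0 < \<bar>t\<bar>\<close> minus_cis'[of "pi * j / n"] by (simp add: sgn_if minus_cis)
  have arg: "\<bar>pi * i / n - (pi * j / n + sgn t * pi)\<bar> = pi - \<bar>t\<bar>"
  proof -
    have "pi * i / n - (pi * j / n + sgn t * pi) = t - sgn t * pi" by (simp add: t_def)
    then show ?thesis using tpi \<open>0 < \<bar>t\<bar>\<close> by (auto simp: sgn_if abs_if)
  qed
  have opp: "circle_dist L (cis (pi * i / n)) (- cis (pi * j / n)) \<le> L / 2 * (1 - 1 / n)"
    unfolding shift using circle_dist_cis[of "pi * i / n" "pi * j / n + sgn t * pi" L, unfolded arg]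
      t(1) tpi bound[of "pi - \<bar>t\<bar>"] by (simp add: algebra_simps)
  show ?thesis
    using assms(5,6) same opp circle_dist_minus[of L "cis (pi * i / n)" "cis (pi * j / n)"]
      circle_dist_minus[of L "cis (pi * i / n)" "- cis (pi * j / n)"]
    by auto
qed

section \<open>The bound on the length of the circle\<close>

context Metric_space
begin

lemma coarse_helly_circle_bound:
  fixes n :: nat
  assumes "\<delta> \<ge> 0" "coarse_helly \<delta>" "n > 0" "L > 0" "K \<ge> 1"
    and f: "qi_embedding (sphere 0 1) (circle_dist L) M d K C f"
    and card: "\<And>p. p \<in> M \<Longrightarrow> finite (mcball p (4 * \<delta> + 2)) \<and> card (mcball p (4 * \<delta> + 2)) < 2 ^ n"
  shows "L * (1 / (2 * K) - K / 2 * (1 - 1 / n)) \<le> 2 * C + 2 * \<delta> + 2"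
proof (rule ccontr)
  assume "\<not> ?thesis"
  then have big: "2 * C + 2 * \<delta> + 2 < L * (1 / (2 * K) - K / 2 * (1 - 1 / n))" by simp
  define z where "z i s = (if s then 1 else - 1) * cis (pi * real i / n)" for i :: nat and s :: bool
  define x where "x i s = f (z i s)" for i s
  have z: "z i s \<in> sphere 0 1" for i s by (simp add: z_def norm_mult)
  have x: "x i s \<in> M" for i s using f z unfolding qi_embedding_def x_def by blast
  have lo: "1 / K * circle_dist L u v - C \<le> d (f u) (f v)"
    and up: "d (f u) (f v) \<le> K * circle_dist L u v + C"
    if "u \<in> sphere 0 1" "v \<in> sphere 0 1" for u v
    using f that unfolding qi_embedding_def by blast+
  have D: "1 / K * (L / 2) - C \<le> d (x i True) (x i False)" for i
    using lo[OF z z, of i True i False] circle_dist_antipodal[of L "pi * i / n"]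
    by (simp add: x_def z_def)
  have E: "d (x i s) (x j s') \<le> K * (L / 2 * (1 - 1 / n)) + C" if "i < n" "j < n" "i \<noteq> j" for i j s s'
  proof -
    have "circle_dist L (z i s) (z j s') \<le> L / 2 * (1 - 1 / n)"
      unfolding z_def using that assms(4) by (intro circle_dist_roots) auto
    then have "K * circle_dist L (z i s) (z j s') \<le> K * (L / 2 * (1 - 1 / n))"
      using assms(5) by (intro mult_left_mono) auto
    then show ?thesis using up[OF z z, of i s j s'] unfolding x_def by linarith
  qed
  \<comment> \<open>This is the slack for \<open>r = \<delta> + 1\<close>, for which the confining
    ball has radius \<open>2 * r + 2 * \<delta> = 4 * \<delta> + 2\<close>.\<close>
  have big': "K * (L / 2 * (1 - 1 / n)) + C + 2 * (\<delta> + 1) \<le> 1 / K * (L / 2) - C"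
    using big by (simp add: algebra_simps)
  have "0 \<le> K * (L / 2 * (1 - 1 / n)) + C"
  proof -
    have "0 \<le> C" using up[OF z z, of 0 True 0 True] x[of 0 True] by (simp add: x_def circle_dist_def z_def)
    then show ?thesis using assms(3-5) by (intro add_nonneg_nonneg mult_nonneg_nonneg) auto
  qed
  then have D': "2 * (\<delta> + 1) \<le> d (x i True) (x i False)" for i
    using D[of i] big' by linarith
  have slack: "d (x i s) (x j s') + 2 * (\<delta> + 1)
      \<le> (d (x i True) (x i False) + d (x j True) (x j False)) / 2"
    if "i < n" "j < n" "i \<noteq> j" for i j s s'
    using E[OF that, of s s'] D[of i] D[of j] big' by argo
  obtain p where "p \<in> M" and "finite (mcball p (2 * (\<delta> + 1) + 2 * \<delta>)) \<Longrightarrow>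
      2 ^ n \<le> card (mcball p (2 * (\<delta> + 1) + 2 * \<delta>))"
    by (rule coarse_helly_antipodal_pairs[OF assms(2), of "\<delta> + 1" n x])
      (use x D' slack assms(1) in auto)
  with card[of p] show False by (simp add: algebra_simps)
qed

end

theorem theoremB:
  fixes M :: "'a set" and d :: "'a \<Rightarrow> 'a \<Rightarrow> real"
  assumes "Metric_space M d"
    and "Metric_space.coarsely_injective M d"
    and "Metric_space.uniformly_bounded_geometry M d"
  shows "Metric_space.strongly_shortcut M d"
proof -
  interpret Metric_space M d by (fact assms(1))
  obtain \<delta> where \<delta>: "\<delta> \<ge> 0" "coarse_helly \<delta>"
    using coarsely_injective_imp_coarse_helly assms(2) by blast
  have "0 < 4 * \<delta> + 2" using \<delta> by simp
  then obtain N where N: "\<And>p. p \<in> M \<Longrightarrow> finite (mcball p (4 * \<delta> + 2)) \<and> card (mcball p (4 * \<delta> + 2)) \<le> N"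
    using assms(3) unfolding uniformly_bounded_geometry_def by blast
  define n where "n = Suc N"
  have "N < 2 ^ n" using less_exp[of n] unfolding n_def by linarith
  then have card: "finite (mcball p (4 * \<delta> + 2)) \<and> card (mcball p (4 * \<delta> + 2)) < 2 ^ n" if "p \<in> M" for p
    using N[OF that] by auto
  \<comment> \<open>Positivity of \<open>\<epsilon>\<close> means
    \<open>K\<^sup>2 * (1 - 1 / n) < 1\<close>; here the left side is
    \<open>1 - (1 / n)\<^sup>2\<close>. Neither \<open>n\<close> nor \<open>K\<close> depends on
    \<open>C\<close>.\<close>
  define K where "K = sqrt (1 + 1 / n)"
  define \<epsilon> where "\<epsilon> = 1 / (2 * K) - K / 2 * (1 - 1 / n)"
  have "n > 0" by (simp add: n_def)
  have "K > 1" using \<open>n > 0\<close> by (simp add: K_def)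
  have "K ^ 2 = 1 + 1 / n" by (simp add: K_def)
  then have "K\<^sup>2 * (1 - 1 / n) = 1 - (1 / n)\<^sup>2" by (simp add: algebra_simps power2_eq_square)
  then have "2 * K * \<epsilon> = (1 / n)\<^sup>2"
    using \<open>K > 1\<close> unfolding \<epsilon>_def by (simp add: right_diff_distrib power2_eq_square)
  moreover have "0 < (1 / real n)\<^sup>2" using \<open>n > 0\<close> by simp
  ultimately have "0 < 2 * K * \<epsilon>" by argo
  then have "\<epsilon> > 0" using \<open>K > 1\<close> by (simp add: zero_less_mult_iff)
  have "L \<le> (2 * C + 2 * \<delta> + 2) / \<epsilon>"
    if "L > 0" "qi_embedding (sphere 0 1) (circle_dist L) M d K C f" for C L f
    using coarse_helly_circle_bound[OF \<delta> \<open>n > 0\<close> that(1) _ that(2) card] \<open>K > 1\<close> \<open>\<epsilon> > 0\<close>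
    unfolding \<epsilon>_def[symmetric] by (simp add: pos_le_divide_eq)
  with \<open>K > 1\<close> coarse_helly_imp_roughly_geodesic[OF \<delta>] show ?thesis
    unfolding strongly_shortcut_def by blast
qed

end
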